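(* Let $p>3$ be a prime, $n\in\mathbb{Z}_p$ and $3n+2\not\equiv 0\pmod p$. Then $$\sum_{k=1}^{[p/3]}\binom{3k}{k}\big(n^2(n+1)\big)^k\equiv \frac{3(n+1)}{2(3n+2)}\left(\Big(\frac{(1+n)(1-3n)}{p}\Big)-1\right)\pmod p,$$ where $\big(\frac{(1+n)(1-3n)}{p}\big)$ is the Legendre symbol.
   Context: For a prime $p$, $\mathbb{Z}_p$ denotes the set of rational numbers whose denominator is not divisible by $p$; congruences modulo $p$ are taken in this ring. $[x]$ is the greatest integer not exceeding $x$. The Legendre symbol $\big(\frac{a}{p}\big)$ of $a\in\mathbb{Z}_p$ is that of the residue class of $a$ modulo $p$ (it is $0$ when $a\equiv 0\pmod p$). *)

theory Defs
  imports "HOL-Number_Theory.Number_Theory"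
begin

definition Zp :: "nat \<Rightarrow> rat set"
  where "Zp p = {x. \<not> int p dvd snd (quotient_of x)}"

text \<open>
  The generic congruence \<^const>\<open>cong\<close> is not usable here: \<^typ>\<open>rat\<close> is a field, and the relevant
  ring is the subring \<^term>\<open>Zp p\<close>.  The relation holds only between elements of that subring.
\<close>

definition Zp_cong :: "nat \<Rightarrow> rat \<Rightarrow> rat \<Rightarrow> bool"
  where "Zp_cong p x y \<longleftrightarrow> x \<in> Zp p \<and> y \<in> Zp p \<and> (\<exists>z\<in>Zp p. x - y = of_nat p * z)"

text \<open>
  The representative in \<open>{0..<p}\<close> of the residue class of \<^term>\<open>x\<close>; it exists and is unique when
  \<^term>\<open>p\<close> is prime and \<^term>\<open>x \<in> Zp p\<close> (lemma \<open>Zp_residue_ex1\<close> below).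
\<close>

definition Zp_residue :: "nat \<Rightarrow> rat \<Rightarrow> int"
  where "Zp_residue p x = (THE r. r \<in> {0..<int p} \<and> Zp_cong p x (of_int r))"

definition Zp_Legendre :: "rat \<Rightarrow> nat \<Rightarrow> int"
  where "Zp_Legendre x p = Legendre (Zp_residue p x) (int p)"

lemma of_int_in_Zp: "prime p \<Longrightarrow> of_int a \<in> Zp p"
  by (auto simp: Zp_def dest: prime_gt_1_nat)

lemma Zp_iff:
  assumes "prime p"
  shows "x \<in> Zp p \<longleftrightarrow> (\<exists>a b. \<not> int p dvd b \<and> x = of_int a / of_int b)"
proof
  assume "x \<in> Zp p"
  obtain a b where ab: "quotient_of x = (a, b)"
    by (cases "quotient_of x")
  with \<open>x \<in> Zp p\<close> show "\<exists>a b. \<not> int p dvd b \<and> x = of_int a / of_int b"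
    using quotient_of_div[OF ab] by (auto simp: Zp_def)
next
  assume "\<exists>a b. \<not> int p dvd b \<and> x = of_int a / of_int b"
  then obtain a b where b: "\<not> int p dvd b" and x: "x = of_int a / of_int b"
    by blast
  obtain c d where cd: "quotient_of x = (c, d)"
    by (cases "quotient_of x")
  have x': "x = of_int c / of_int d" and d: "d > 0" and cop: "coprime c d"
    using quotient_of_div[OF cd] quotient_of_denom_pos[OF cd] quotient_of_coprime[OF cd] by auto
  have "b \<noteq> 0"
    using b by auto
  then have "(of_int (a * d) :: rat) = of_int (c * b)"
    using x x' d by (simp add: field_simps)
  then have "a * d = c * b"
    by (simp only: of_int_eq_iff)
  then have "d dvd c * b"
    by (metis dvd_triv_right)
  then have "d dvd b"
    using cop by (simp add: coprime_commute coprime_dvd_mult_right_iff)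
  then show "x \<in> Zp p"
    using b cd dvd_trans by (auto simp: Zp_def)
qed

lemma Zp_cong_of_int_iff:
  assumes p: "prime p" and b: "\<not> int p dvd b"
  shows "Zp_cong p (of_int a / of_int b) (of_int r) \<longleftrightarrow> int p dvd a - r * b"
proof -
  have b0: "b \<noteq> 0" and p0: "p \<noteq> 0"
    using b p by auto
  have memb: "of_int a / of_int b \<in> Zp p" "of_int r \<in> Zp p"
    using b Zp_iff[OF p] of_int_in_Zp[OF p] by blast+
  have pp: "prime (int p)"
    using p by simp
  show ?thesis
  proof
    assume "Zp_cong p (of_int a / of_int b) (of_int r)"
    then obtain z where z: "z \<in> Zp p" and e': "of_int a / of_int b - of_int r = of_nat p * z"
      by (auto simp: Zp_cong_def)
    obtain c d where d: "\<not> int p dvd d" and zcd: "z = of_int c / of_int d"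
      using z Zp_iff[OF p] by blast
    have e: "of_int a / of_int b - of_int r = of_nat p * (of_int c / of_int d :: rat)"
      using e' zcd by simp
    have d0: "d \<noteq> 0"
      using d by auto
    have "of_int ((a - r * b) * d) = (of_int (int p * c * b) :: rat)"
      using e b0 d0 by (simp add: field_simps)
    then have "(a - r * b) * d = int p * c * b"
      by (simp only: of_int_eq_iff)
    then have "int p dvd (a - r * b) * d"
      by simp
    then show "int p dvd a - r * b"
      using d prime_dvd_mult_iff[OF pp] by blast
  next
    assume "int p dvd a - r * b"
    then obtain c where c: "a - r * b = int p * c"
      by blast
    have "a = r * b + int p * c"
      using c by simp
    then have "of_int a / of_int b - of_int r = of_nat p * (of_int c / of_int b :: rat)"
      using b0 by (simp add: field_simps)
    moreover have "of_int c / of_int b \<in> Zp p"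
      using b Zp_iff[OF p] by blast
    ultimately show "Zp_cong p (of_int a / of_int b) (of_int r)"
      using memb unfolding Zp_cong_def by blast
  qed
qed

lemma Zp_residue_ex1:
  assumes p: "prime p" and x: "x \<in> Zp p"
  shows "\<exists>!r. r \<in> {0..<int p} \<and> Zp_cong p x (of_int r)"
proof -
  obtain a b where b: "\<not> int p dvd b" and xab: "x = of_int a / of_int b"
    using x Zp_iff[OF p] by blast
  have pp: "prime (int p)" and pos: "int p > 0"
    using p by (auto simp: prime_gt_0_nat)
  have cop: "coprime b (int p)"
    using prime_imp_coprime[OF pp b] by (simp add: coprime_commute)
  then obtain i where i: "[b * i = 1] (mod int p)"
    using cong_solve_coprime_int by blast
  have iff: "Zp_cong p x (of_int r) \<longleftrightarrow> [r * b = a] (mod int p)" for r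
    unfolding xab Zp_cong_of_int_iff[OF p b]
    by (simp add: cong_iff_dvd_diff dvd_diff_commute)
  have "[(a * i) mod int p * b = a] (mod int p)"
  proof -
    have "[(a * i) mod int p * b = a * i * b] (mod int p)"
      by (intro cong_mult) (auto simp: cong_def)
    also have "[a * i * b = a * 1] (mod int p)"
      using cong_mult[OF cong_refl[of a] i] by (simp add: ac_simps)
    finally show ?thesis
      by simp
  qed
  then have "(a * i) mod int p \<in> {0..<int p} \<and> Zp_cong p x (of_int ((a * i) mod int p))"
    unfolding iff using pos by simp
  moreover have "r = s" if "r \<in> {0..<int p} \<and> Zp_cong p x (of_int r)"
    "s \<in> {0..<int p} \<and> Zp_cong p x (of_int s)" for r s
  proof -
    have "[r * b = s * b] (mod int p)"
      using that unfolding iff by (metis cong_sym cong_trans)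
    then have "[r = s] (mod int p)"
      using cop by (simp add: cong_mult_rcancel)
    then show ?thesis
      using that by (auto simp: cong_def)
  qed
  ultimately show ?thesis
    by (metis (no_types, lifting))
qed

end

theory Submission
  imports Defs
begin

text \<open>
  For \<open>3k < p\<close> one has \<open>binom(p - 1 - 2k, k) \<equiv> (-1)\<^sup>k binom(3k, k)\<close> modulo \<open>p\<close>, so with \<open>x = n\<^sup>2(n + 1)\<close>
  the sum plus one is congruent to \<open>u\<^bsub>p-1\<^esub>\<close>, where
  \<open>u\<^sub>m = \<Sum>\<^sub>k binom(m - 2k, k) (-x)\<^sup>k\<close> satisfies \<open>u\<^bsub>m+3\<^esub> = u\<^bsub>m+2\<^esub> - x u\<^sub>m\<close>.  The characteristic
  polynomial factors as
  \<open>t\<^sup>3 - t\<^sup>2 + x = (t + n)(t\<^sup>2 - (n + 1)t + n(n + 1))\<close>, and the quadratic factor has discriminant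
  \<open>D = (1 + n)(1 - 3n)\<close>.  Partial fractions express \<open>(3n + 2) u\<^sub>m\<close> by \<open>(-n)\<^sup>m\<close> and the Lucas
  sequence of the quadratic factor, whose values near the index \<open>p\<close> follow from the Frobenius
  congruence \<open>(P + s)\<^sup>p \<equiv> P + D\<^bsup>(p-1)/2\<^esup> s\<close> with \<open>P = n + 1\<close>, \<open>s\<^sup>2 = D\<close> and Euler's criterion.  All of this is
  done for an integer representing \<open>n\<close> modulo \<open>p\<close>.
\<close>

section \<open>Lucas sequences as coefficients of powers of \<open>P + s\<close>\<close>

fun lucas_U :: "'a::comm_ring_1 \<Rightarrow> 'a \<Rightarrow> nat \<Rightarrow> 'a" where
  "lucas_U P Q 0 = 0"
| "lucas_U P Q (Suc 0) = 1"
| "lucas_U P Q (Suc (Suc m)) = P * lucas_U P Q (Suc m) - Q * lucas_U P Q m"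

text \<open>For \<open>c i = s ^ i\<close> this is \<open>(P + s) ^ m\<close>. Leaving
  \<open>c\<close> arbitrary allows a formal square root to be used without an extension ring:
  \<open>c i\<close> is a coefficient of \<open>s ^ i\<close>.\<close>

definition binomial_transform :: "'a::comm_ring_1 \<Rightarrow> (nat \<Rightarrow> 'a) \<Rightarrow> nat \<Rightarrow> 'a"
  where "binomial_transform P c m = (\<Sum>i\<le>m. of_nat (m choose i) * P ^ (m - i) * c i)"

text \<open>Pascal's rule; it mirrors multiplication by \<open>P + s\<close>, with the shift of
  \<open>c\<close> as multiplication by \<open>s\<close>.\<close>

lemma binomial_transform_Suc:
  "binomial_transform P c (Suc m) =
     P * binomial_transform P c m + binomial_transform P (\<lambda>i. c (Suc i)) m"
proof -
  have A: "(\<Sum>i\<le>m. of_nat (m choose Suc i) * P ^ (m - i) * c (Suc i)) =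
     P * binomial_transform P c m - P ^ Suc m * c 0"
  proof -
    have "P * binomial_transform P c m = (\<Sum>i\<le>Suc m. of_nat (m choose i) * P ^ (Suc m - i) * c i)"
      by (simp add: binomial_transform_def sum_distrib_left Suc_diff_le binomial_eq_0 ac_simps)
    then show ?thesis
      by (simp add: sum.atMost_Suc_shift del: sum.atMost_Suc)
  qed
  have "binomial_transform P c (Suc m) =
      P ^ Suc m * c 0 + (\<Sum>i\<le>m. of_nat (Suc m choose Suc i) * P ^ (m - i) * c (Suc i))"
    unfolding binomial_transform_def by (simp add: sum.atMost_Suc_shift del: sum.atMost_Suc binomial_Suc_Suc)
  also have "\<dots> = P ^ Suc m * c 0 + binomial_transform P (\<lambda>i. c (Suc i)) m
      + (\<Sum>i\<le>m. of_nat (m choose Suc i) * P ^ (m - i) * c (Suc i))"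
    by (simp add: binomial_transform_def sum.distrib algebra_simps)
  finally show ?thesis
    unfolding A by simp
qed

text \<open>
  The coefficient of a formal square root \<open>s\<close> of \<open>D\<close> in the power \<open>s\<^sup>i\<close>; its
  \<^const>\<open>binomial_transform\<close> at \<open>m\<close> is therefore the coefficient of \<open>s\<close> in \<open>(P + s)\<^sup>m\<close>.
\<close>

definition sqrt_odd :: "'a::comm_ring_1 \<Rightarrow> nat \<Rightarrow> 'a"
  where "sqrt_odd D i = (if odd i then D ^ (i div 2) else 0)"

text \<open>Shifting \<open>sqrt_odd D\<close> twice multiplies it by \<open>D\<close>, so the
  recurrence is that of the powers of a root of \<open>t^2 - 2*P*t + (P^2 - D)\<close>.\<close>

lemma binomial_transform_sqrt_odd_rec:
  "binomial_transform P (sqrt_odd D) (Suc (Suc m)) =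
     2 * P * binomial_transform P (sqrt_odd D) (Suc m)
     - (P\<^sup>2 - D) * binomial_transform P (sqrt_odd D) m"
proof -
  have "binomial_transform P (\<lambda>i. sqrt_odd D (Suc (Suc i))) m = D * binomial_transform P (sqrt_odd D) m"
    by (simp add: binomial_transform_def sqrt_odd_def sum_distrib_left ac_simps if_distrib cong: if_cong)
  then show ?thesis
    by (simp add: binomial_transform_Suc algebra_simps power2_eq_square)
qed

text \<open>Binet's formula for the roots \<open>(P + s)/2\<close> and \<open>(P - s)/2\<close>,
  freed of division by \<open>s\<close> and by powers of 2.\<close>

lemma power_2_lucas_U:
  fixes P Q D :: "'a::comm_ring_1"
  assumes "P\<^sup>2 - D = 4 * Q"
  shows "2 ^ m * lucas_U P Q m = 2 * binomial_transform P (sqrt_odd D) m"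
proof (induction m rule: induct_nat_012)
  case (ge2 m)
  have "2 ^ Suc (Suc m) * lucas_U P Q (Suc (Suc m)) =
      2 * P * (2 ^ Suc m * lucas_U P Q (Suc m)) - 4 * Q * (2 ^ m * lucas_U P Q m)"
    by (simp add: algebra_simps)
  then show ?case
    unfolding ge2 binomial_transform_sqrt_odd_rec assms by (simp add: algebra_simps)
qed (simp_all add: binomial_transform_def sqrt_odd_def)

section \<open>Diagonal binomial sums and their third-order recurrence\<close>

definition diag_sum :: "'a::comm_ring_1 \<Rightarrow> nat \<Rightarrow> 'a"
  where "diag_sum y m = (\<Sum>k\<le>m div 3. of_nat ((m - 2 * k) choose k) * y ^ k)"

text \<open>The added terms vanish; this puts sums with different \<open>m\<close> over a common
  range.\<close>

lemma diag_sum_eq: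
  assumes "m div 3 \<le> N"
  shows "diag_sum y m = (\<Sum>k\<le>N. of_nat ((m - 2 * k) choose k) * y ^ k)"
  unfolding diag_sum_def
proof (intro sum.mono_neutral_left ballI)
  fix k assume "k \<in> {..N} - {..m div 3}"
  then have "m - 2 * k < k"
    by auto
  then show "of_nat ((m - 2 * k) choose k) * y ^ k = 0"
    by (simp add: binomial_eq_0)
qed (use assms in auto)

lemma diag_sum_rec: "diag_sum y (m + 3) = diag_sum y (m + 2) + y * diag_sum y m"
proof -
  let ?N = "m div 3"
  \<comment> \<open>If \<open>2 * k > m\<close>, truncated subtraction makes every upper index 0,
    and all three binomials vanish.\<close>
  have pascal: "(m + 3 - 2 * Suc k) choose Suc k =
      ((m + 2 - 2 * Suc k) choose Suc k) + ((m - 2 * k) choose k)" for k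
  proof (cases "2 * k \<le> m")
    case True
    then have "m + 3 - 2 * Suc k = Suc (m - 2 * k)" "m + 2 - 2 * Suc k = m - 2 * k"
      by auto
    then show ?thesis by simp
  qed (auto simp: binomial_eq_0)
  have "diag_sum y (m + 3) = (\<Sum>k\<le>Suc ?N. of_nat ((m + 3 - 2 * k) choose k) * y ^ k)"
    by (rule diag_sum_eq) simp
  also have "\<dots> = 1 + (\<Sum>k\<le>?N. of_nat ((m + 3 - 2 * Suc k) choose Suc k) * y ^ Suc k)"
    by (simp only: sum.atMost_Suc_shift) simp
  also have "\<dots> = 1 + (\<Sum>k\<le>?N. of_nat ((m + 2 - 2 * Suc k) choose Suc k) * y ^ Suc k)
      + y * diag_sum y m"
    unfolding pascal by (simp add: diag_sum_def sum.distrib sum_distrib_left algebra_simps)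
  also have "1 + (\<Sum>k\<le>?N. of_nat ((m + 2 - 2 * Suc k) choose Suc k) * y ^ Suc k) =
      (\<Sum>k\<le>Suc ?N. of_nat ((m + 2 - 2 * k) choose k) * y ^ k)"
    by (simp only: sum.atMost_Suc_shift) simp
  also have "\<dots> = diag_sum y (m + 2)"
    by (rule diag_sum_eq [symmetric]) simp
  finally show ?thesis .
qed

text \<open>Partial fractions with denominators cleared: the quadratic factor takes the value
  \<open>n * (3 * n + 2)\<close> at the root \<open>- n\<close>. Both sides obey the recurrence of
  the cubic and agree for \<open>m < 3\<close>.\<close>

lemma diag_sum_lucas_U:
  fixes n :: "'a::comm_ring_1"
  shows "(3 * n + 2) * diag_sum (- (n\<^sup>2 * (n + 1))) m =
    n * (- n) ^ m + 2 * (n + 1) * lucas_U (n + 1) (n * (n + 1)) (Suc m)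
    - n * (n + 1) * lucas_U (n + 1) (n * (n + 1)) m" (is "?l m = ?r m")
proof (induction m rule: less_induct)
  case (less m)
  show ?case
  proof (cases "m < 3")
    case True
    then have "m \<in> {0, 1, 2}"
      by auto
    then show ?thesis
      by (auto simp: diag_sum_def algebra_simps power2_eq_square numeral_2_eq_2)
  next
    case False
    then obtain j where m: "m = j + 3"
      by (metis add.commute le_Suc_ex not_less)
    have distrib: "c * (A + y * B) = c * A + y * (c * B)" for c A y B :: 'a
      by (simp add: algebra_simps)
    have "?l m = ?l (j + 2) - n\<^sup>2 * (n + 1) * ?l j"
      unfolding m diag_sum_rec distrib by simp
    also have "\<dots> = ?r (j + 2) - n\<^sup>2 * (n + 1) * ?r j"
      using less.IH[of "j + 2"] less.IH[of j] m by simp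
    also have "\<dots> = ?r m"
      unfolding m by (simp add: numeral_3_eq_3 algebra_simps power2_eq_square)
    finally show ?thesis .
  qed
qed

section \<open>Reduction of the binomial sum modulo \<open>p\<close>\<close>

lemma fact_mult_binomial: "fact k * int (m choose k) = (\<Prod>i<k. int m - int i)"
proof -
  have "rat_of_int (fact k * int (m choose k)) = rat_of_int (\<Prod>i<k. int m - int i)"
    using gbinomial_mult_fact[of k "of_nat m :: rat"]
    by (simp add: binomial_gbinomial lessThan_atLeast0)
  then show ?thesis
    by (simp only: of_int_eq_iff)
qed

text \<open>Multiplied by \<open>fact k\<close>, a unit modulo \<open>p\<close>, both sides become
  products of \<open>k\<close> integers that are congruent factor by factor.\<close>

lemma cong_binomial_triple:
  assumes p: "prime p" and k: "3 * k < p"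
  shows "[int ((p - 1 - 2 * k) choose k) = (- 1) ^ k * int ((3 * k) choose k)] (mod int p)"
proof -
  have "fact k * int ((3 * k) choose k) = (\<Prod>i<k. int (3 * k) - int (k - Suc i))"
    unfolding fact_mult_binomial by (rule prod.nat_diff_reindex [symmetric])
  also have "\<dots> = (\<Prod>i<k. int (2 * k + 1 + i))"
    by (intro prod.cong) (auto simp: of_nat_diff)
  finally have "(- 1) ^ k * (fact k * int ((3 * k) choose k)) = (\<Prod>i<k. - int (2 * k + 1 + i))"
    by (simp only: prod_uminus card_lessThan)
  then have "fact k * ((- 1) ^ k * int ((3 * k) choose k)) = (\<Prod>i<k. - int (2 * k + 1 + i))"
    by (simp only: mult.left_commute)
  moreover have "[(\<Prod>i<k. int (p - 1 - 2 * k) - int i) = (\<Prod>i<k. - int (2 * k + 1 + i))] (mod int p)"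
  proof (intro cong_prod)
    fix i
    have "int (p - 1 - 2 * k) - int i = - int (2 * k + 1 + i) + int p"
      using k by (simp add: of_nat_diff)
    then show "[int (p - 1 - 2 * k) - int i = - int (2 * k + 1 + i)] (mod int p)"
      by (simp only: cong_iff_dvd_diff add_diff_cancel_left' dvd_refl)
  qed
  ultimately have "[fact k * int ((p - 1 - 2 * k) choose k) =
      fact k * ((- 1) ^ k * int ((3 * k) choose k))] (mod int p)"
    by (simp only: fact_mult_binomial)
  moreover have "coprime (fact k) (int p)"
  proof -
    have "\<not> int p dvd int (fact k)"
      using prime_dvd_fact_iff[OF p] k by (simp only: int_dvd_int_iff)
    then show ?thesis
      using p prime_imp_coprime[of "int p" "fact k"] by (simp add: coprime_commute)
  qed
  ultimately show ?thesis
    by (simp add: cong_mult_lcancel)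
qed

lemma cong_sum_binomial_triple:
  assumes p: "prime p" and p3: "p > 3"
  shows "[(\<Sum>k = 1..p div 3. int ((3 * k) choose k) * x ^ k) = diag_sum (- x) (p - 1) - 1] (mod int p)"
proof -
  \<comment> \<open>This keeps every \<open>k\<close> in the range below \<open>p / 3\<close> and
    makes the ranges for \<open>p\<close> and \<open>p - 1\<close> coincide.\<close>
  have "\<not> 3 dvd p"
    using p p3 by (metis less_irrefl_nat one_eq_numeral_iff prime_nat_iff semiring_norm(86))
  then have *: "3 * (p div 3) < p" 
    by presburger
  have div: "(p - 1) div 3 = p div 3"
    using \<open>\<not> 3 dvd p\<close> p3 by presburger
  have "diag_sum (- x) (p - 1) - 1 = (\<Sum>k = 1..p div 3. int ((p - 1 - 2 * k) choose k) * (- x) ^ k)"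
    unfolding diag_sum_def div by (simp add: atMost_atLeast0 sum.atLeast_Suc_atMost)
  also have "[\<dots> = (\<Sum>k = 1..p div 3. int ((3 * k) choose k) * x ^ k)] (mod int p)"
  proof (intro cong_sum)
    fix k assume "k \<in> {1..p div 3}"
    with * have "3 * k < p"
      by auto
    from cong_scalar_right[OF cong_binomial_triple[OF p this], of "(- x) ^ k"]
    show "[int ((p - 1 - 2 * k) choose k) * (- x) ^ k = int ((3 * k) choose k) * x ^ k] (mod int p)"
      by (simp add: power_minus[of x] ac_simps flip: power_add mult_2)
  qed
  finally show ?thesis
    by (rule cong_sym)
qed

section \<open>Frobenius congruence and Lucas sequences near a prime index\<close>

lemma fermat_int:
  assumes p: "prime p"
  shows "[(a::int) ^ p = a] (mod int p)"
proof (cases "int p dvd a")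
  case True
  then show ?thesis
    using p by (metis cong_0_iff cong_sym cong_trans dvd_power dvd_trans prime_gt_0_nat)
next
  case False
  define b where "b = nat (a mod int p)"
  have b: "[a = int b] (mod int p)"
    using p by (simp add: b_def cong_def prime_gt_0_nat)
  then have "\<not> p dvd b"
    using False by (metis cong_dvd_iff int_dvd_int_iff cong_def)
  then have "[b ^ (p - 1) = 1] (mod p)"
    by (rule fermat_theorem[OF p])
  then have "[int b ^ (p - 1) = 1] (mod int p)"
    by (metis cong_int_iff of_nat_1 of_nat_power)
  then have "[a ^ (p - 1) = 1] (mod int p)"
    using cong_pow[OF b] cong_trans by blast
  from cong_scalar_left[OF this, of a] show ?thesis
    using p by (simp add: prime_gt_0_nat flip: power_Suc)
qed

text \<open>The coefficient form of \<open>(P + s)^p = P^p + s^p\<close>: the inner binomial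
  coefficients are divisible by \<open>p\<close>.\<close>

lemma binomial_transform_prime:
  fixes P :: int
  assumes p: "prime p"
  shows "[binomial_transform P c p = P ^ p * c 0 + c p] (mod int p)"
proof -
  have "p > 0"
    using p by (rule prime_gt_0_nat)
  have "binomial_transform P c p = P ^ p * c 0 + c p +
      (\<Sum>i\<in>{1..<p}. int (p choose i) * P ^ (p - i) * c i)"
  proof -
    have "{..p} = insert 0 (insert p {1..<p})"
      using \<open>p > 0\<close> by auto
    then show ?thesis
      using \<open>p > 0\<close> unfolding binomial_transform_def by simp
  qed
  moreover have "int p dvd (\<Sum>i\<in>{1..<p}. int (p choose i) * P ^ (p - i) * c i)"
  proof (intro dvd_sum)
    fix i assume "i \<in> {1..<p}"
    then have "p dvd p choose i"
      using p by (intro dvd_choose_prime) auto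
    then show "int p dvd int (p choose i) * P ^ (p - i) * c i"
      by (simp add: dvd_mult2)
  qed
  ultimately show ?thesis
    by (simp add: cong_iff_dvd_diff)
qed

lemma lucas_U_prime:
  fixes P Q D :: int
  assumes p: "prime p" "p > 2" and D: "P\<^sup>2 - D = 4 * Q"
  shows "[lucas_U P Q p = D ^ ((p - 1) div 2)] (mod int p)"
    and "[2 * lucas_U P Q (Suc p) = P * D ^ ((p - 1) div 2) + P] (mod int p)"
proof -
  have odd: "odd p"
    using p prime_odd_nat by blast
  have cop: "coprime 2 (int p)"
    using odd by simp
  have half: "p div 2 = (p - 1) div 2"
    using odd by presburger
  let ?b = "binomial_transform P (sqrt_odd D)" and ?e = "D ^ ((p - 1) div 2)"
  have b: "[?b p = ?e] (mod int p)"
    using binomial_transform_prime[OF p(1), of P "sqrt_odd D"] odd by (simp add: sqrt_odd_def half)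
  \<comment> \<open>The shifted sequence picks out the constant coefficient of \<open>s ^ i\<close>;
    its entry at the odd index \<open>p\<close> is 0.\<close>
  have "[binomial_transform P (\<lambda>i. sqrt_odd D (Suc i)) p = P ^ p] (mod int p)"
    using binomial_transform_prime[OF p(1), of P "\<lambda>i. sqrt_odd D (Suc i)"] odd
    by (simp add: sqrt_odd_def)
  then have a: "[binomial_transform P (\<lambda>i. sqrt_odd D (Suc i)) p = P] (mod int p)"
    using fermat_int[OF p(1)] cong_trans by blast
  have two: "[2 ^ p * z = 2 * z] (mod int p)" for z
    using fermat_int[OF p(1), of 2] by (rule cong_scalar_right)
  have "[2 * lucas_U P Q p = 2 * ?b p] (mod int p)"
    using two[of "lucas_U P Q p"] unfolding power_2_lucas_U[OF D] by (rule cong_sym)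
  then have "[lucas_U P Q p = ?b p] (mod int p)"
    using cop by (simp add: cong_mult_lcancel)
  then show "[lucas_U P Q p = ?e] (mod int p)"
    using b cong_trans by blast
  have "2 * (2 ^ p * lucas_U P Q (Suc p)) = 2 * ?b (Suc p)"
    using power_2_lucas_U[OF D, of "Suc p"] by (simp add: mult.assoc)
  then have "[2 * lucas_U P Q (Suc p) = ?b (Suc p)] (mod int p)"
    using two[of "lucas_U P Q (Suc p)"] by (simp add: cong_sym)
  also have "[?b (Suc p) = P * ?e + P] (mod int p)"
    unfolding binomial_transform_Suc by (intro cong_add cong_scalar_left a b)
  finally show "[2 * lucas_U P Q (Suc p) = P * ?e + P] (mod int p)" .
qed

text \<open>The integer form of the result, with denominators cleared and Euler's power in place of
  the Legendre symbol.\<close>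

lemma cong_sum_binomial_triple_closed:
  fixes n :: int
  assumes p: "prime p" "p > 3"
  shows "[2 * (3 * n + 2) * (\<Sum>k = 1..p div 3. int ((3 * k) choose k) * (n\<^sup>2 * (n + 1)) ^ k) =
    3 * (n + 1) * (((1 + n) * (1 - 3 * n)) ^ ((p - 1) div 2) - 1)] (mod int p)"
proof -
  let ?U = "lucas_U (n + 1) (n * (n + 1))"
  let ?e = "((1 + n) * (1 - 3 * n)) ^ ((p - 1) div 2)"
  have D: "(n + 1)\<^sup>2 - (1 + n) * (1 - 3 * n) = 4 * (n * (n + 1))"
    by (simp add: algebra_simps power2_eq_square)
  have "p > 2"
    using p by simp
  note U = lucas_U_prime[OF p(1) this D]
  have "even (p - 1)"
    using p prime_odd_nat[of p] by simp
  have Sp: "Suc (p - 1) = p"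
    using p by simp
  have np: "n * (- n) ^ (p - 1) = n ^ p"
    using \<open>even (p - 1)\<close> Sp by (simp flip: power_Suc)
  \<comment> \<open>Running the recurrence backwards trades index \<open>p - 1\<close> for
    \<open>p\<close> and \<open>Suc p\<close>, whose residues are known.\<close>
  have rec: "n * (n + 1) * ?U (p - 1) = (n + 1) * ?U p - ?U (Suc p)"
    using lucas_U.simps(3)[of "n + 1" "n * (n + 1)" "p - 1"] unfolding Sp by simp
  have "2 * (3 * n + 2) * (diag_sum (- (n\<^sup>2 * (n + 1))) (p - 1) - 1) =
      2 * ((3 * n + 2) * diag_sum (- (n\<^sup>2 * (n + 1))) (p - 1)) - 2 * (3 * n + 2)"
    by (simp add: algebra_simps)
  also have "\<dots> = 2 * n ^ p + 2 * (n + 1) * ?U p + 2 * ?U (Suc p) - 2 * (3 * n + 2)"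
    unfolding diag_sum_lucas_U Sp np rec by (simp add: algebra_simps)
  also have "[\<dots> = 2 * n + 2 * (n + 1) * ?e + ((n + 1) * ?e + (n + 1)) - 2 * (3 * n + 2)] (mod int p)"
    by (intro cong_add cong_diff cong_scalar_left U fermat_int p cong_refl)
  also have "2 * n + 2 * (n + 1) * ?e + ((n + 1) * ?e + (n + 1)) - 2 * (3 * n + 2)
      = 3 * (n + 1) * (?e - 1)"
    by (simp add: algebra_simps)
  finally show ?thesis
    using cong_scalar_left[OF cong_sum_binomial_triple[OF p, of "n\<^sup>2 * (n + 1)"]] cong_trans by blast
qed

section \<open>Congruence arithmetic in \<open>Zp p\<close> and transfer from integers\<close>

lemma Zp_add: assumes "prime p" "x \<in> Zp p" "y \<in> Zp p" shows "x + y \<in> Zp p"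
proof -
  obtain a b c d where *: "\<not> int p dvd b" "\<not> int p dvd d"
    "x = of_int a / of_int b" "y = of_int c / of_int d"
    using assms Zp_iff by metis
  then have "b \<noteq> 0" "d \<noteq> 0"
    by auto
  then have "x + y = of_int (a * d + c * b) / of_int (b * d)"
    using * by (simp add: field_simps)
  moreover have "\<not> int p dvd b * d"
    using * assms(1) by (simp add: prime_dvd_mult_iff)
  ultimately show ?thesis
    using Zp_iff[OF assms(1)] by blast
qed

lemma Zp_mult: assumes "prime p" "x \<in> Zp p" "y \<in> Zp p" shows "x * y \<in> Zp p"
proof -
  obtain a b c d where *: "\<not> int p dvd b" "\<not> int p dvd d"
    "x = of_int a / of_int b" "y = of_int c / of_int d"
    using assms Zp_iff by metis
  then have "x * y = of_int (a * c) / of_int (b * d)"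
    by simp
  moreover have "\<not> int p dvd b * d"
    using * assms(1) by (simp add: prime_dvd_mult_iff)
  ultimately show ?thesis
    using Zp_iff[OF assms(1)] by blast
qed

lemma Zp_uminus: assumes "prime p" "x \<in> Zp p" shows "- x \<in> Zp p"
  using Zp_mult[OF assms(1) of_int_in_Zp[OF assms(1), of "- 1"] assms(2)] by simp

lemma Zp_cong_refl: "prime p \<Longrightarrow> x \<in> Zp p \<Longrightarrow> Zp_cong p x x"
  using of_int_in_Zp[of p 0] by (auto simp: Zp_cong_def intro!: bexI[of _ 0])

lemma Zp_cong_sym: assumes "prime p" "Zp_cong p x y" shows "Zp_cong p y x"
proof -
  obtain z where "z \<in> Zp p" "x - y = of_nat p * z"
    using assms by (auto simp: Zp_cong_def)
  then have "- z \<in> Zp p" "y - x = of_nat p * (- z)"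
    using Zp_uminus[OF assms(1)] by (auto simp: algebra_simps)
  then show ?thesis
    using assms unfolding Zp_cong_def by blast
qed

lemma Zp_cong_add:
  assumes p: "prime p" and "Zp_cong p x y" "Zp_cong p x' y'"
  shows "Zp_cong p (x + x') (y + y')"
proof -
  obtain z z' where z: "z \<in> Zp p" "x - y = of_nat p * z" "z' \<in> Zp p" "x' - y' = of_nat p * z'"
    using assms by (auto simp: Zp_cong_def)
  then have "x + x' - (y + y') = of_nat p * (z + z')"
    by (simp add: algebra_simps)
  then show ?thesis
    using assms z Zp_add[OF p] unfolding Zp_cong_def by blast
qed

lemma Zp_cong_trans:
  assumes p: "prime p" and "Zp_cong p x y" "Zp_cong p y z"
  shows "Zp_cong p x z"
proof -
  obtain u v where u: "u \<in> Zp p" "x - y = of_nat p * u" "v \<in> Zp p" "y - z = of_nat p * v"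
    using assms by (auto simp: Zp_cong_def)
  then have "x - z = of_nat p * (u + v)"
    by (simp add: algebra_simps)
  then show ?thesis
    using assms u Zp_add[OF p] unfolding Zp_cong_def by blast
qed

lemma Zp_cong_mult:
  assumes p: "prime p" and "Zp_cong p x y" "Zp_cong p x' y'"
  shows "Zp_cong p (x * x') (y * y')"
proof -
  obtain z z' where z: "z \<in> Zp p" "x - y = of_nat p * z" "z' \<in> Zp p" "x' - y' = of_nat p * z'"
    using assms by (auto simp: Zp_cong_def)
  have "x * x' - y * y' = (x - y) * x' + y * (x' - y')"
    by (simp add: algebra_simps)
  also have "\<dots> = of_nat p * (z * x' + y * z')"
    by (simp add: z algebra_simps)
  finally have "x * x' - y * y' = of_nat p * (z * x' + y * z')" .
  moreover have "z * x' + y * z' \<in> Zp p" "x * x' \<in> Zp p" "y * y' \<in> Zp p"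
    using assms z Zp_add[OF p] Zp_mult[OF p] by (auto simp: Zp_cong_def)
  ultimately show ?thesis
    unfolding Zp_cong_def by blast
qed

lemma Zp_cong_of_int: "prime p \<Longrightarrow> Zp_cong p (of_int a) (of_int b) \<longleftrightarrow> [a = b] (mod int p)"
  using Zp_cong_of_int_iff[of p 1 a b] prime_gt_1_nat[of p] by (simp add: cong_iff_dvd_diff)

lemma Zp_cong_of_int_refl: "prime p \<Longrightarrow> Zp_cong p (of_int a) (of_int a)"
  by (simp add: Zp_cong_of_int)

lemma Zp_cong_power: "prime p \<Longrightarrow> Zp_cong p x y \<Longrightarrow> Zp_cong p (x ^ k) (y ^ k)"
  by (induction k) (use Zp_cong_of_int_refl[of p 1] in \<open>auto intro: Zp_cong_mult\<close>)

lemma Zp_cong_sum: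
  assumes "prime p" "\<And>i. i \<in> A \<Longrightarrow> Zp_cong p (f i) (g i)"
  shows "Zp_cong p (sum f A) (sum g A)"
  using assms(2)
  by (induction A rule: infinite_finite_induct)
    (use Zp_cong_of_int_refl[OF assms(1), of 0] in \<open>auto intro: Zp_cong_add[OF assms(1)]\<close>)

text \<open>An element not congruent to 0 has a numerator prime to \<open>p\<close>.\<close>

lemma Zp_inverse:
  assumes p: "prime p" and x: "x \<in> Zp p" and "\<not> Zp_cong p x 0"
  shows "inverse x \<in> Zp p"
proof -
  obtain a b where ab: "\<not> int p dvd b" "x = of_int a / of_int b"
    using x Zp_iff[OF p] by blast
  then have "\<not> int p dvd a"
    using Zp_cong_of_int_iff[OF p ab(1), of a 0] assms(3) by simp
  moreover have "inverse x = of_int b / of_int a"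
    using ab by simp
  ultimately show ?thesis
    using Zp_iff[OF p] by blast
qed

lemma Zp_cong_divide:
  assumes p: "prime p" and a: "a \<in> Zp p" "\<not> Zp_cong p a 0" and "Zp_cong p (a * x) y" 
  shows "Zp_cong p x (y / a)"
proof -
  have "a \<noteq> 0"
    using a Zp_cong_refl[OF p] by auto
  moreover have "Zp_cong p (inverse a * (a * x)) (inverse a * y)"
    using assms Zp_cong_refl[OF p Zp_inverse[OF p a]] by (intro Zp_cong_mult)
  ultimately show ?thesis
    by (simp add: field_simps)
qed

lemma Zp_residue_cong:
  assumes "prime p" "x \<in> Zp p"
  shows "Zp_cong p x (of_int (Zp_residue p x))"
  using theI'[OF Zp_residue_ex1[OF assms]] by (simp add: Zp_residue_def)

text \<open>Euler's criterion, stated for any integer representative \<open>a\<close> of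
  \<open>x\<close>.\<close>

lemma Zp_Legendre_cong:
  assumes p: "prime p" "p > 2" and x: "Zp_cong p x (of_int a)"
  shows "[Zp_Legendre x p = a ^ ((p - 1) div 2)] (mod int p)"
proof -
  let ?r = "Zp_residue p x"
  have "Zp_cong p (of_int ?r) (of_int a)"
    using x p Zp_residue_cong[of p x] Zp_cong_sym Zp_cong_trans by (metis Zp_cong_def)
  then have "[?r = a] (mod int p)"
    using p Zp_cong_of_int by blast
  then have "[?r ^ ((p - 1) div 2) = a ^ ((p - 1) div 2)] (mod int p)"
    by (rule cong_pow)
  then show ?thesis
    using euler_criterion[OF p, of ?r] cong_trans unfolding Zp_Legendre_def by blast
qed

theorem theorem2p3:
  fixes p :: nat and n :: rat
  assumes "prime p" and "p > 3"
    and "n \<in> Zp p"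
    and "\<not> Zp_cong p (3 * n + 2) 0"
  shows "Zp_cong p
    (\<Sum>k = 1..p div 3. of_nat ((3 * k) choose k) * (n\<^sup>2 * (n + 1)) ^ k)
    (3 * (n + 1) / (2 * (3 * n + 2)) * (of_int (Zp_Legendre ((1 + n) * (1 - 3 * n)) p) - 1))"
proof -
  note p = \<open>prime p\<close>
  note Zp_cong_trans[OF p, trans]
  define N where "N = Zp_residue p n"
  have N: "Zp_cong p n (of_int N)"
    unfolding N_def using assms by (intro Zp_residue_cong)
  note I = Zp_cong_of_int_refl[OF p]
  \<comment> \<open>These rules cover sums, products, powers and constants; differences are
    therefore written below as sums with negated constants.\<close>
  note cong = Zp_cong_add[OF p] Zp_cong_mult[OF p] Zp_cong_power[OF p] Zp_cong_sum[OF p] N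
    I I[of 1, simplified] I[of "- 1", simplified] I[of "numeral k" for k, simplified]
    I[of "- numeral k" for k, simplified] I[of "int k" for k, simplified]
  define S where "S x = (\<Sum>k = 1..p div 3. of_nat ((3 * k) choose k) * (x\<^sup>2 * (x + 1)) ^ k)"
    for x :: rat
  define L where "L = Zp_Legendre ((1 + n) * (1 - 3 * n)) p"
  define E where "E = ((1 + N) * (1 - 3 * N)) ^ ((p - 1) div 2)"
  have "Zp_cong p ((1 + n) * (1 + (- 3) * n)) ((1 + of_int N) * (1 + (- 3) * of_int N))"
    by (intro cong)
  then have "Zp_cong p ((1 + n) * (1 - 3 * n)) (of_int ((1 + N) * (1 - 3 * N)))"
    by simp
  then have "[L = E] (mod int p)"
    unfolding L_def E_def using assms by (intro Zp_Legendre_cong) auto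
  then have L: "Zp_cong p (of_int E) (of_int L)"
    using Zp_cong_of_int[OF p] cong_sym by blast
  have "Zp_cong p (2 * (3 * n + 2) * S n) (2 * (3 * of_int N + 2) * S (of_int N))"
    unfolding S_def by (intro cong)
  also
  have "Zp_cong p (2 * (3 * of_int N + 2) * S (of_int N)) (3 * (of_int N + 1) * (of_int E + (- 1)))"
    using cong_sum_binomial_triple_closed[OF p \<open>p > 3\<close>, of N]
    unfolding E_def[symmetric] Zp_cong_of_int[OF p, symmetric] by (simp add: S_def)
  also
  have "Zp_cong p (3 * (of_int N + 1) * (of_int E + (- 1))) (3 * (n + 1) * (of_int L + (- 1)))"
    by (intro cong L Zp_cong_sym[OF p N])
  finally
  have main: "Zp_cong p (2 * ((3 * n + 2) * S n)) (3 * (n + 1) * (of_int L - 1))"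
    by (simp only: mult.assoc add_uminus_conv_diff)
  have two: "(2::rat) \<in> Zp p" "\<not> Zp_cong p 2 0"
    using of_int_in_Zp[OF p, of 2] Zp_cong_of_int[OF p, of 2 0] \<open>p > 3\<close>
    by (auto simp: cong_0_iff dest: zdvd_imp_le)
  have unit: "3 * n + 2 \<in> Zp p"
    using Zp_add[OF p] Zp_mult[OF p] two(1) of_int_in_Zp[OF p, of 3] \<open>n \<in> Zp p\<close> by simp
  \<comment> \<open>Both 2 and \<open>3 * n + 2\<close> are units of \<open>Zp p\<close>, so they
    are divided out in turn.\<close>
  from Zp_cong_divide[OF p unit assms(4) Zp_cong_divide[OF p two main]]
  show ?thesis
    unfolding S_def L_def by (simp add: mult_ac)
qed

end
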